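(* Let $\{M_i\}_{i=1}^k$ be a family of species of structures ($k\ge1$). Then there is an isomorphism of species $$\big(\widetilde{\boxdot}_{i=1}^k M_i\big)(E_+)=\times_{i=1}^k\, M_i(E_+),$$ where $\times$ is the cartesian product of species, $(M\times N)[U]=M[U]\times N[U]$.
   Context: A species of structures is a functor $F$ from the category of finite sets and bijections to itself; $F[U]$ is the finite set of $F$-structures on $U$. Equality of species means natural isomorphism. A $k$-partial rectangle on a finite set $U$ is a tuple $(\pi_1,\dots,\pi_k)$ of set partitions of $U$ with $\pi_1\wedge\cdots\wedge\pi_k=\hat0$ (the partition into singletons; $\wedge$ is the meet in the refinement order, i.e. common refinement by block intersections). $P_{\mathcal{R}}^{(k)}[U]$ is the set of these. The modified arithmetic product of species $M_1,\dots,M_k$ is $$(\widetilde{\boxdot}_{i=1}^kM_i)[U]=\sum_{(\pi_1,\dots,\pi_k)\in P_{\mathcal{R}}^{(k)}[U]}\ \prod_{i=1}^kM_i[\pi_i]$$ (disjoint union). A bijection $\sigma:U\to V$ sends $\pi_i$ to $\sigma(\pi_i)=\{\sigma(A)\mid A\in\pi_i\}$ and transports the $M_i$-structure along the induced bijection $\pi_i\to\sigma(\pi_i)$, $A\mapsto\sigma(A)$. $E_+$ is the species of nonempty sets ($E_+[U]=\{U\}$ for $U\neq\varnothing$, $E_+[\varnothing]=\varnothing$), and $M(E_+)$ denotes substitution: $M(E_+)[U]=\sum_{\pi}M[\pi]$ (disjoint union), the sum over all set partitions $\pi$ of $U$. *)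

theory Defs
  imports Main "HOL-Library.FSet" "HOL-Library.FuncSet" "HOL-Library.Disjoint_Sets"
begin

text \<open>
  A species is evaluated at a set \<open>U\<close>, at partitions of \<open>U\<close>, and at partitions of partitions
  of \<open>U\<close>, whereas a HOL function has a single argument type. The underlying sets therefore live
  in a universe \<open>'a hf\<close> of hereditarily finite sets over atoms of type \<open>'a\<close>, which contains
  every finite set of its elements again as an element. The finite subsets of \<open>'a hf\<close> contain
  sets of every finite cardinality, so with bijections they form a category equivalent to that
  of all finite sets and bijections.
\<close>

datatype 'a hf = Atom 'a | HSet "'a hf fset"

text \<open>\<open>enc\<close> is meaningful (and injective) on finite sets only.\<close>

definition enc :: "'a hf set \<Rightarrow> 'a hf" where
  "enc A = HSet (Abs_fset A)"

primrec dec :: "'a hf \<Rightarrow> 'a hf set" where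
  "dec (Atom a) = {}"
| "dec (HSet A) = fset A"

lemma dec_enc [simp]: "finite A \<Longrightarrow> dec (enc A) = A"
  by (simp add: enc_def Abs_fset_inverse)

lemma inj_on_enc: "inj_on enc {A. finite A}"
  by (rule inj_on_inverseI [where g = dec]) simp

text \<open>
  \<open>transport F U \<sigma>\<close> is the map \<open>F[U] \<rightarrow> F[V]\<close> induced by a bijection \<open>\<sigma> : U \<rightarrow> V\<close>; the
  codomain is determined as \<open>V = \<sigma> ` U\<close>. Only finite \<open>U\<close> matter.
\<close>

record ('u, 's) species_data =
  structures :: "'u set \<Rightarrow> 's set"
  transport :: "'u set \<Rightarrow> ('u \<Rightarrow> 'u) \<Rightarrow> 's \<Rightarrow> 's"

text \<open>
  Arrows are bijections between sets, represented by total HOL functions; the last condition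
  says that their values outside \<open>U\<close> are irrelevant.
\<close>

definition species :: "('u, 's) species_data \<Rightarrow> bool" where
  "species F \<longleftrightarrow>
     (\<forall>U. finite U \<longrightarrow> finite (structures F U)) \<and>
     (\<forall>U V \<sigma>. finite U \<and> bij_betw \<sigma> U V \<longrightarrow>
        bij_betw (transport F U \<sigma>) (structures F U) (structures F V)) \<and>
     (\<forall>U. finite U \<longrightarrow> (\<forall>s\<in>structures F U. transport F U id s = s)) \<and>
     (\<forall>U V W \<sigma> \<tau>. finite U \<and> bij_betw \<sigma> U V \<and> bij_betw \<tau> V W \<longrightarrow>
        (\<forall>s\<in>structures F U. transport F U (\<tau> \<circ> \<sigma>) s = transport F V \<tau> (transport F U \<sigma> s))) \<and>
     (\<forall>U V \<sigma> \<tau>. finite U \<and> bij_betw \<sigma> U V \<and> (\<forall>u\<in>U. \<sigma> u = \<tau> u) \<longrightarrow>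
        (\<forall>s\<in>structures F U. transport F U \<sigma> s = transport F U \<tau> s))"

definition natural_iso ::
  "('u, 's) species_data \<Rightarrow> ('u, 't) species_data \<Rightarrow> ('u set \<Rightarrow> 's \<Rightarrow> 't) \<Rightarrow> bool" where
  "natural_iso F G \<eta> \<longleftrightarrow>
     (\<forall>U. finite U \<longrightarrow> bij_betw (\<eta> U) (structures F U) (structures G U)) \<and>
     (\<forall>U V \<sigma>. finite U \<and> bij_betw \<sigma> U V \<longrightarrow>
        (\<forall>s\<in>structures F U. \<eta> V (transport F U \<sigma> s) = transport G U \<sigma> (\<eta> U s)))"

definition isomorphic_species ::
  "('u, 's) species_data \<Rightarrow> ('u, 't) species_data \<Rightarrow> bool" where
  "isomorphic_species F G \<longleftrightarrow> species F \<and> species G \<and> (\<exists>\<eta>. natural_iso F G \<eta>)"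

text \<open>Used for \<open>k \<ge> 1\<close> only: for \<open>k = 0\<close> the intersection below would be \<open>UNIV\<close>.\<close>

definition partitions_meet :: "nat \<Rightarrow> (nat \<Rightarrow> 'u set set) \<Rightarrow> 'u set set" where
  "partitions_meet k \<pi> = {\<Inter>i\<in>{1..k}. B i | B. \<forall>i\<in>{1..k}. B i \<in> \<pi> i} - {{}}"

definition partial_rectangles :: "nat \<Rightarrow> 'u set \<Rightarrow> (nat \<Rightarrow> 'u set set) set" where
  "partial_rectangles k U =
     {\<pi> \<in> {1..k} \<rightarrow>\<^sub>E {P. partition_on U P}. partitions_meet k \<pi> = (\<lambda>u. {u}) ` U}"

text \<open>
  For a partition \<open>P\<close> of a finite set, \<open>enc ` P\<close> is \<open>P\<close> as an object of the category, and
  \<open>block_map \<sigma>\<close> is the induced bijection \<open>A \<mapsto> \<sigma>(A)\<close> on encoded blocks.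
\<close>

definition block_map :: "('a hf \<Rightarrow> 'a hf) \<Rightarrow> 'a hf \<Rightarrow> 'a hf" where
  "block_map \<sigma> x = enc (\<sigma> ` dec x)"

definition modified_arithmetic_product ::
  "nat \<Rightarrow> (nat \<Rightarrow> ('a hf, 's) species_data) \<Rightarrow>
   ('a hf, (nat \<Rightarrow> 'a hf set set) \<times> (nat \<Rightarrow> 's)) species_data" where
  "modified_arithmetic_product k M =
     \<lparr>structures = (\<lambda>U. SIGMA \<pi>:partial_rectangles k U.
          \<Pi>\<^sub>E i\<in>{1..k}. structures (M i) (enc ` \<pi> i)),
      transport = (\<lambda>U \<sigma> (\<pi>, m).
          (\<lambda>i\<in>{1..k}. (`) \<sigma> ` \<pi> i,
           \<lambda>i\<in>{1..k}. transport (M i) (enc ` \<pi> i) (block_map \<sigma>) (m i)))\<rparr>"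

text \<open>
  The substitution \<open>M(E\<^sub>+)\<close>. Since \<open>E\<^sub>+\<close> has exactly one structure on each block of a partition,
  a structure is just a partition together with an \<open>M\<close>-structure on its set of blocks.
\<close>

definition subst_nonempty_sets ::
  "('a hf, 's) species_data \<Rightarrow> ('a hf, 'a hf set set \<times> 's) species_data" where
  "subst_nonempty_sets M =
     \<lparr>structures = (\<lambda>U. SIGMA P:{P. partition_on U P}. structures M (enc ` P)),
      transport = (\<lambda>U \<sigma> (P, m). ((`) \<sigma> ` P, transport M (enc ` P) (block_map \<sigma>) m))\<rparr>"

definition cartesian_product ::
  "nat \<Rightarrow> (nat \<Rightarrow> ('u, 's) species_data) \<Rightarrow> ('u, nat \<Rightarrow> 's) species_data" where
  "cartesian_product k M =
     \<lparr>structures = (\<lambda>U. \<Pi>\<^sub>E i\<in>{1..k}. structures (M i) U),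
      transport = (\<lambda>U \<sigma> m. \<lambda>i\<in>{1..k}. transport (M i) U \<sigma> (m i))\<rparr>"

end

theory Submission imports Defs begin

text \<open>
  A structure on the left is a partition \<open>Q\<close> of \<open>U\<close>, a partial rectangle \<open>\<pi>\<close> on the set of
  blocks of \<open>Q\<close>, and for each \<open>i\<close> an \<open>M\<^sub>i\<close>-structure on the blocks of \<open>\<pi>\<^sub>i\<close>. A partition of the
  set of blocks of \<open>Q\<close> is the same thing as a partition of \<open>U\<close> coarser than \<open>Q\<close>: replace each
  block, which is a set of blocks of \<open>Q\<close>, by its union. So \<open>\<pi>\<close> becomes a family \<open>P\<close> of partitions
  of \<open>U\<close> coarser than \<open>Q\<close>. Taking unions of blocks of \<open>Q\<close> commutes with intersections, because
  these blocks are disjoint; hence the meet of \<open>\<pi>\<close> is the partition into singletons exactly when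
  the meet of \<open>P\<close> is \<open>Q\<close>. Thus \<open>(Q, \<pi>)\<close> carries the same information as an arbitrary family \<open>P\<close>
  of \<open>k\<close> partitions of \<open>U\<close>: given \<open>P\<close>, the partition \<open>Q\<close> can only be its meet, and each \<open>P\<^sub>i\<close> is
  coarser than that meet. The blocks of \<open>\<pi>\<^sub>i\<close> and of \<open>P\<^sub>i\<close> correspond one to one, and
  \<open>M\<^sub>i\<close>-structures are transported along this bijection. This is the map \<open>coarsen\<close>; it commutes
  with relabelling because images of sets commute with unions.

  Both facts about partitions, the equivariance of the meet under a bijection and its behaviour
  under unions of blocks, are instances of one statement, \<open>partitions_meet_inflate\<close>: replacing the
  points of a set by disjoint nonempty sets preserves meets. The bijection \<open>\<sigma>\<close> replaces a point
  \<open>x\<close> by \<open>{\<sigma> x}\<close>, and the union of blocks replaces an encoded block by its set of elements.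

  That the two sides are species is reduced to the substitution \<open>M(E\<^sub>+)\<close> and the cartesian product:
  the modified arithmetic product sits inside the cartesian product of the \<open>M\<^sub>i(E\<^sub>+)\<close>, as the
  families of partitions whose meet is trivial, and inherits the functor laws
  (\<open>species_of_embedding\<close>).
\<close>

section \<open>Working with species\<close>

lemma species_finite:
  "species F \<Longrightarrow> finite U \<Longrightarrow> finite (structures F U)"
  by (simp add: species_def)

lemma species_transport_bij:
  "species F \<Longrightarrow> finite U \<Longrightarrow> bij_betw \<sigma> U V \<Longrightarrow>
    bij_betw (transport F U \<sigma>) (structures F U) (structures F V)"
  by (simp add: species_def)

lemma species_transport_in:
  "species F \<Longrightarrow> finite U \<Longrightarrow> bij_betw \<sigma> U V \<Longrightarrow> s \<in> structures F U \<Longrightarrow>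
    transport F U \<sigma> s \<in> structures F V"
  using bij_betwE[OF species_transport_bij] by blast

lemma species_transport_id:
  "species F \<Longrightarrow> finite U \<Longrightarrow> s \<in> structures F U \<Longrightarrow> transport F U id s = s"
  by (simp add: species_def)

lemma species_transport_comp:
  "species F \<Longrightarrow> finite U \<Longrightarrow> bij_betw \<sigma> U V \<Longrightarrow> bij_betw \<tau> V W \<Longrightarrow> s \<in> structures F U \<Longrightarrow>
    transport F U (\<tau> \<circ> \<sigma>) s = transport F V \<tau> (transport F U \<sigma> s)"
  unfolding species_def by blast

lemma species_transport_cong:
  assumes "species F" "finite U" "bij_betw \<sigma> U V" "\<And>u. u \<in> U \<Longrightarrow> \<sigma> u = \<tau> u"
    "s \<in> structures F U"
  shows "transport F U \<sigma> s = transport F U \<tau> s"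
  using assms(2-)
    assms(1)[unfolded species_def, THEN conjunct2, THEN conjunct2, THEN conjunct2, THEN conjunct2]
  by blast

text \<open>
  Bijectivity of the transport maps follows from the functor laws: transport along the inverse
  bijection is an inverse, since the composite agrees with \<open>id\<close> on the underlying set.
\<close>

lemma speciesI:
  assumes fin: "\<And>U. finite U \<Longrightarrow> finite (structures F U)"
    and closed: "\<And>U V \<sigma> s. finite U \<Longrightarrow> bij_betw \<sigma> U V \<Longrightarrow> s \<in> structures F U \<Longrightarrow>
      transport F U \<sigma> s \<in> structures F V"
    and ident: "\<And>U s. finite U \<Longrightarrow> s \<in> structures F U \<Longrightarrow> transport F U id s = s"
    and comp: "\<And>U V W \<sigma> \<tau> s. finite U \<Longrightarrow> bij_betw \<sigma> U V \<Longrightarrow> bij_betw \<tau> V W \<Longrightarrow>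
      s \<in> structures F U \<Longrightarrow> transport F U (\<tau> \<circ> \<sigma>) s = transport F V \<tau> (transport F U \<sigma> s)"
    and cong: "\<And>U V \<sigma> \<tau> s. finite U \<Longrightarrow> bij_betw \<sigma> U V \<Longrightarrow> (\<And>u. u \<in> U \<Longrightarrow> \<sigma> u = \<tau> u) \<Longrightarrow>
      s \<in> structures F U \<Longrightarrow> transport F U \<sigma> s = transport F U \<tau> s"
  shows "species F"
proof -
  have cancel: "transport F V \<tau> (transport F U \<sigma> s) = s"
    if "finite U" "bij_betw \<sigma> U V" "bij_betw \<tau> V U" "\<And>u. u \<in> U \<Longrightarrow> \<tau> (\<sigma> u) = u"
      "s \<in> structures F U" for U V \<sigma> \<tau> s
  proof -
    have "transport F V \<tau> (transport F U \<sigma> s) = transport F U (\<tau> \<circ> \<sigma>) s"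
      using comp that by simp
    also have "\<dots> = transport F U id s"
      using that by (intro cong[where V = U] bij_betw_trans[where B = V]) auto
    finally show ?thesis using ident that by simp
  qed
  have "bij_betw (transport F U \<sigma>) (structures F U) (structures F V)"
    if U: "finite U" and \<sigma>: "bij_betw \<sigma> U V" for U V \<sigma>
  proof (rule bij_betw_byWitness)
    let ?\<tau> = "inv_into U \<sigma>"
    have V: "finite V" using U \<sigma> bij_betw_finite by blast
    have \<tau>: "bij_betw ?\<tau> V U" using \<sigma> by (rule bij_betw_inv_into)
    show "\<forall>s\<in>structures F U. transport F V ?\<tau> (transport F U \<sigma> s) = s"
      using cancel[OF U \<sigma> \<tau>] \<sigma> by (simp add: bij_betw_inv_into_left)
    show "\<forall>s\<in>structures F V. transport F U \<sigma> (transport F V ?\<tau> s) = s"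
      using cancel[OF V \<tau> \<sigma>] \<sigma> by (simp add: bij_betw_inv_into_right)
    show "transport F U \<sigma> ` structures F U \<subseteq> structures F V"
      using closed[OF U \<sigma>] by blast
    show "transport F V ?\<tau> ` structures F V \<subseteq> structures F U"
      using closed[OF V \<tau>] by blast
  qed
  then show ?thesis
    unfolding species_def
    using fin ident comp by (intro conjI allI impI ballI) (auto intro: cong)
qed

text \<open>
  Each functor law is an equation between structures, so it may be checked after applying the
  injective natural map \<open>\<eta>\<close>, where it is the law for \<open>G\<close>.
\<close>

lemma species_of_embedding:
  assumes G: "species G"
    and inj: "\<And>U. finite U \<Longrightarrow> inj_on (\<eta> U) (structures F U)"
    and into: "\<And>U s. finite U \<Longrightarrow> s \<in> structures F U \<Longrightarrow> \<eta> U s \<in> structures G U"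
    and closed: "\<And>U V \<sigma> s. finite U \<Longrightarrow> bij_betw \<sigma> U V \<Longrightarrow> s \<in> structures F U \<Longrightarrow>
      transport F U \<sigma> s \<in> structures F V"
    and natural: "\<And>U V \<sigma> s. finite U \<Longrightarrow> bij_betw \<sigma> U V \<Longrightarrow> s \<in> structures F U \<Longrightarrow>
      \<eta> V (transport F U \<sigma> s) = transport G U \<sigma> (\<eta> U s)"
  shows "species F"
proof (rule speciesI)
  fix U :: "'a set" assume U: "finite U"
  show "finite (structures F U)"
    by (rule inj_on_finite[OF inj[OF U] _ species_finite[OF G U]]) (use into U in blast)
next
  fix U :: "'a set" and s assume U: "finite U" and s: "s \<in> structures F U"
  have id: "bij_betw id U U" by simp
  show "transport F U id s = s"
    by (rule inj_onD[OF inj[OF U] _ closed[OF U id s] s])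
      (use natural[OF U id s] species_transport_id[OF G U into[OF U s]] in simp)
next
  fix U V W :: "'a set" and \<sigma> \<tau> s
  assume U: "finite U" and \<sigma>: "bij_betw \<sigma> U V" and \<tau>: "bij_betw \<tau> V W" and s: "s \<in> structures F U"
  have V: "finite V" using U \<sigma> bij_betw_finite by blast
  have W: "finite W" using V \<tau> bij_betw_finite by blast
  have c: "bij_betw (\<tau> \<circ> \<sigma>) U W" using \<sigma> \<tau> by (rule bij_betw_trans)
  show "transport F U (\<tau> \<circ> \<sigma>) s = transport F V \<tau> (transport F U \<sigma> s)"
    by (rule inj_onD[OF inj[OF W] _ closed[OF U c s] closed[OF V \<tau> closed[OF U \<sigma> s]]])
      (simp add: natural[OF U c s] natural[OF V \<tau> closed[OF U \<sigma> s]] natural[OF U \<sigma> s]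
        species_transport_comp[OF G U \<sigma> \<tau> into[OF U s]])
next
  fix U V :: "'a set" and \<sigma> \<tau> s
  assume U: "finite U" and \<sigma>: "bij_betw \<sigma> U V" and eq: "\<And>u. u \<in> U \<Longrightarrow> \<sigma> u = \<tau> u"
    and s: "s \<in> structures F U"
  have V: "finite V" using U \<sigma> bij_betw_finite by blast
  have \<tau>: "bij_betw \<tau> U V" using \<sigma> eq bij_betw_cong by blast
  show "transport F U \<sigma> s = transport F U \<tau> s"
    by (rule inj_onD[OF inj[OF V] _ closed[OF U \<sigma> s] closed[OF U \<tau> s]])
      (simp add: natural[OF U \<sigma> s] natural[OF U \<tau> s]
        species_transport_cong[OF G U \<sigma> eq into[OF U s]])
qed (use closed in blast)

lemma species_cartesian_product:
  assumes M: "\<And>i. i \<in> {1..k} \<Longrightarrow> species (M i)"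
  shows "species (cartesian_product k M)"
proof -
  have mem: "s \<in> structures (cartesian_product k M) U \<longleftrightarrow>
      s \<in> (\<Pi>\<^sub>E i\<in>{1..k}. structures (M i) U)" for s U
    by (simp add: cartesian_product_def)
  have component: "s i \<in> structures (M i) U"
    if "s \<in> structures (cartesian_product k M) U" "i \<in> {1..k}" for s U i
    using that unfolding mem by (rule PiE_mem)
  have tr: "transport (cartesian_product k M) U \<sigma> s =
      (\<lambda>i\<in>{1..k}. transport (M i) U \<sigma> (s i))" for U \<sigma> s
    by (simp add: cartesian_product_def)
  show ?thesis
  proof (rule speciesI, goal_cases)
    case (1 U)
    have "finite (\<Pi>\<^sub>E i\<in>{1..k}. structures (M i) U)"
      by (intro finite_PiE species_finite M 1) auto
    then show ?case by (simp add: cartesian_product_def)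
  next
    case (2 U V \<sigma> s)
    then show ?case
      unfolding mem[of _ V] tr restrict_PiE_iff
      by (intro ballI species_transport_in[OF M] component)
  next
    case (3 U s)
    have "(\<lambda>i\<in>{1..k}. transport (M i) U id (s i)) = (\<lambda>i\<in>{1..k}. s i)"
      by (rule restrict_ext) (rule species_transport_id[OF M _ component], use 3 in simp_all)
    also have "\<dots> = s" using 3(2) unfolding mem by (rule PiE_restrict)
    finally show ?case unfolding tr .
  next
    case (4 U V W \<sigma> \<tau> s)
    have "transport (M i) U (\<tau> \<circ> \<sigma>) (s i) = transport (M i) V \<tau> (transport (M i) U \<sigma> (s i))"
      if "i \<in> {1..k}" for i
      by (rule species_transport_comp[OF M[OF that] 4(1,2,3) component[OF 4(4) that]])
    then show ?case unfolding tr by (simp cong: restrict_cong)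
  next
    case (5 U V \<sigma> \<tau> s)
    have "transport (M i) U \<sigma> (s i) = transport (M i) U \<tau> (s i)" if "i \<in> {1..k}" for i
      by (rule species_transport_cong[OF M[OF that] 5(1,2,3) component[OF 5(4) that]])
    then show ?case unfolding tr by (simp cong: restrict_cong)
  qed
qed

section \<open>Replacing points by disjoint nonempty sets\<close>

lemma partition_on_block_subset: "partition_on U P \<Longrightarrow> p \<in> P \<Longrightarrow> p \<subseteq> U"
  by (auto simp: partition_on_def)

lemma finite_blocks: "partition_on U P \<Longrightarrow> finite U \<Longrightarrow> p \<in> P \<Longrightarrow> finite p"
  by (rule finite_subset[OF partition_on_block_subset])

lemma partition_on_same_block:
  "partition_on U P \<Longrightarrow> p \<in> P \<Longrightarrow> q \<in> P \<Longrightarrow> u \<in> p \<Longrightarrow> u \<in> q \<Longrightarrow> p = q"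
  using disjointD[OF partition_onD2] by blast

definition inflate :: "('u \<Rightarrow> 'v set) \<Rightarrow> 'u set \<Rightarrow> 'v set" where
  "inflate g X = (\<Union>x\<in>X. g x)"

locale disjoint_fibres =
  fixes g :: "'u \<Rightarrow> 'v set" and A :: "'u set"
  assumes fibre_nonempty: "x \<in> A \<Longrightarrow> g x \<noteq> {}"
    and fibre_unique: "x \<in> A \<Longrightarrow> y \<in> A \<Longrightarrow> v \<in> g x \<Longrightarrow> v \<in> g y \<Longrightarrow> x = y"
begin

lemma inflate_mono_iff:
  assumes "X \<subseteq> A" "Y \<subseteq> A"
  shows "inflate g X \<subseteq> inflate g Y \<longleftrightarrow> X \<subseteq> Y"
proof
  assume sub: "inflate g X \<subseteq> inflate g Y"
  show "X \<subseteq> Y"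
  proof
    fix x assume x: "x \<in> X"
    then obtain v where v: "v \<in> g x" using fibre_nonempty assms by blast
    then obtain y where "y \<in> Y" "v \<in> g y" using sub x by (auto simp: inflate_def)
    then show "x \<in> Y" using fibre_unique v x assms by blast
  qed
qed (auto simp: inflate_def)

lemma inj_on_inflate: "inj_on (inflate g) (Pow A)"
  by (rule inj_onI) (metis PowD inflate_mono_iff order_antisym order_refl)

lemma inflate_eq_empty_iff: "X \<subseteq> A \<Longrightarrow> inflate g X = {} \<longleftrightarrow> X = {}"
  using fibre_nonempty by (auto simp: inflate_def)

lemma inflate_INT:
  assumes "I \<noteq> {}" "\<And>i. i \<in> I \<Longrightarrow> B i \<subseteq> A"
  shows "inflate g (\<Inter>i\<in>I. B i) = (\<Inter>i\<in>I. inflate g (B i))"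
proof
  show "(\<Inter>i\<in>I. inflate g (B i)) \<subseteq> inflate g (\<Inter>i\<in>I. B i)"
  proof
    fix v assume v: "v \<in> (\<Inter>i\<in>I. inflate g (B i))"
    obtain j where j: "j \<in> I" using assms by blast
    then obtain x where x: "x \<in> B j" "v \<in> g x" using v by (auto simp: inflate_def)
    have "x \<in> B i" if i: "i \<in> I" for i
    proof -
      obtain y where y: "y \<in> B i" "v \<in> g y" using v i by (auto simp: inflate_def)
      have "x = y" using fibre_unique x y i j assms by blast
      with y show ?thesis by simp
    qed
    with x show "v \<in> inflate g (\<Inter>i\<in>I. B i)" by (auto simp: inflate_def)
  qed
qed (auto simp: inflate_def)

lemma partition_on_inflate:
  assumes P: "partition_on A P"
  shows "partition_on (inflate g A) (inflate g ` P)"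
proof (rule partition_onI)
  have sub: "X \<subseteq> A" if "X \<in> P" for X using P that by (rule partition_on_block_subset)
  show "{} \<notin> inflate g ` P"
    using partition_onD3[OF P] inflate_eq_empty_iff[OF sub] by (metis imageE)
  show "\<Union> (inflate g ` P) = inflate g A"
    using partition_onD1[OF P] by (auto simp: inflate_def)
  fix p q assume pq: "p \<in> inflate g ` P" "q \<in> inflate g ` P" "p \<noteq> q"
  then obtain X Y where XY: "X \<in> P" "Y \<in> P" "p = inflate g X" "q = inflate g Y" by blast
  with pq have "X \<inter> Y = {}" using disjointD[OF partition_onD2[OF P]] by blast
  then show "disjnt p q"
    using XY sub fibre_unique unfolding disjnt_def inflate_def by blast
qed

text \<open>
  The converse of \<open>partition_on_inflate\<close>, for partitions whose blocks do not cut through any of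
  the sets \<open>g x\<close>. It yields the partial rectangle when \<open>coarsen\<close> below is inverted.
\<close>

lemma partition_on_deflate:
  assumes P: "partition_on (inflate g A) P" and sat: "P \<subseteq> inflate g ` Pow A"
  obtains \<pi> where "partition_on A \<pi>" "inflate g ` \<pi> = P"
proof
  let ?\<pi> = "{X \<in> Pow A. inflate g X \<in> P}"
  show "inflate g ` ?\<pi> = P" using sat by blast
  show "partition_on A ?\<pi>"
  proof (rule partition_onI)
    show "{} \<notin> ?\<pi>"
      using partition_onD3[OF P] by (simp add: inflate_def)
    show "\<Union> ?\<pi> = A"
    proof
      show "A \<subseteq> \<Union> ?\<pi>"
      proof
        fix x assume x: "x \<in> A"
        then obtain v where v: "v \<in> g x" using fibre_nonempty by blast
        then obtain p where p: "p \<in> P" "v \<in> p"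
          using x partition_onD1[OF P] by (auto simp: inflate_def)
        then obtain X where X: "X \<subseteq> A" "p = inflate g X" using sat by blast
        then obtain y where "y \<in> X" "v \<in> g y" using p by (auto simp: inflate_def)
        then have "x \<in> X" using fibre_unique v x X by blast
        then show "x \<in> \<Union> ?\<pi>" using X p by blast
      qed
    qed blast
    fix X Y assume XY: "X \<in> ?\<pi>" "Y \<in> ?\<pi>" "X \<noteq> Y"
    then have "inflate g X \<noteq> inflate g Y" using inj_on_inflate by (auto dest: inj_onD)
    then have "inflate g X \<inter> inflate g Y = {}"
      using XY disjointD[OF partition_onD2[OF P]] by blast
    then have "inflate g (X \<inter> Y) = {}" by (auto simp: inflate_def)
    then show "disjnt X Y"
      using XY inflate_eq_empty_iff[of "X \<inter> Y"] by (auto simp: disjnt_def)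
  qed
qed

lemma image_minus_empty:
  assumes "\<And>X. X \<in> S \<Longrightarrow> f X = {} \<longleftrightarrow> X = {}"
  shows "f ` S - {{}} = f ` (S - {{}})"
  using assms by blast

text \<open>
  By disjointness of the sets \<open>g x\<close>, inflation commutes with the nonempty intersections
  \<open>\<Inter>i\<in>{1..k}. B i\<close>; by their nonemptiness, it produces the empty set, which the meet discards,
  from the empty set only.
\<close>

lemma partitions_meet_inflate:
  assumes k: "k \<ge> 1" and \<pi>: "\<And>i. i \<in> {1..k} \<Longrightarrow> \<pi> i \<subseteq> Pow A"
  shows "partitions_meet k (\<lambda>i. inflate g ` \<pi> i) = inflate g ` partitions_meet k \<pi>"
proof -
  let ?meets = "\<lambda>\<rho>. {\<Inter>i\<in>{1..k}. B i |B. \<forall>i\<in>{1..k}. B i \<in> \<rho> i}"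
  have ne: "{1..k} \<noteq> {}" using k by simp
  have INT: "inflate g (\<Inter>i\<in>{1..k}. B i) = (\<Inter>i\<in>{1..k}. inflate g (B i))"
    if "\<forall>i\<in>{1..k}. B i \<in> \<pi> i" for B
    by (rule inflate_INT[OF ne]) (use that \<pi> in blast)
  have "?meets (\<lambda>i. inflate g ` \<pi> i) = inflate g ` ?meets \<pi>"
  proof (intro set_eqI iffI)
    fix q assume "q \<in> ?meets (\<lambda>i. inflate g ` \<pi> i)"
    then obtain C where C: "\<forall>i\<in>{1..k}. C i \<in> inflate g ` \<pi> i" "q = (\<Inter>i\<in>{1..k}. C i)" by blast
    then have "\<forall>i\<in>{1..k}. \<exists>X. X \<in> \<pi> i \<and> C i = inflate g X" by blast
    then obtain B where B: "\<forall>i\<in>{1..k}. B i \<in> \<pi> i \<and> C i = inflate g (B i)"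
      using bchoice[of "{1..k}" "\<lambda>i X. X \<in> \<pi> i \<and> C i = inflate g X"] by blast
    then have "q = inflate g (\<Inter>i\<in>{1..k}. B i)" using INT[of B] C by simp
    then show "q \<in> inflate g ` ?meets \<pi>" using B by blast
  next
    fix q assume "q \<in> inflate g ` ?meets \<pi>"
    then obtain B where B: "\<forall>i\<in>{1..k}. B i \<in> \<pi> i" "q = inflate g (\<Inter>i\<in>{1..k}. B i)" by blast
    then have "q = (\<Inter>i\<in>{1..k}. inflate g (B i))" using INT by simp
    then show "q \<in> ?meets (\<lambda>i. inflate g ` \<pi> i)" using B(1) by blast
  qed
  moreover have "inflate g X = {} \<longleftrightarrow> X = {}" if X: "X \<in> ?meets \<pi>" for X
  proof (rule inflate_eq_empty_iff)
    have 1: "1 \<in> {1..k}" using k by simp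
    obtain B where "\<forall>i\<in>{1..k}. B i \<in> \<pi> i" "X = (\<Inter>i\<in>{1..k}. B i)"
      using X by blast
    then show "X \<subseteq> A" using \<pi>[OF 1] 1 by blast
  qed
  then have "inflate g ` ?meets \<pi> - {{}} = inflate g ` (?meets \<pi> - {{}})"
    by (rule image_minus_empty)
  ultimately show ?thesis unfolding partitions_meet_def by simp
qed

end

lemma inflate_singletons: "inflate (\<lambda>x. {\<sigma> x}) = (`) \<sigma>"
  by (auto simp: inflate_def fun_eq_iff)

lemma disjoint_fibres_singletons: "inj_on \<sigma> U \<Longrightarrow> disjoint_fibres (\<lambda>x. {\<sigma> x}) U"
  by unfold_locales (auto dest: inj_onD)

text \<open>
  With \<open>g = dec\<close>, inflation sends a set of encoded blocks of \<open>Q\<close> to their union.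
\<close>

lemma disjoint_fibres_dec:
  assumes "partition_on U Q" "finite U"
  shows "disjoint_fibres dec (enc ` Q)"
    and "inflate dec (enc ` Q) = U"
proof -
  have fin: "finite q" if "q \<in> Q" for q
    using assms that by (rule finite_blocks)
  show "disjoint_fibres dec (enc ` Q)"
  proof
    show "dec x \<noteq> {}" if "x \<in> enc ` Q" for x
      using that fin partition_onD3[OF assms(1)] by auto
    show "x = y" if xy: "x \<in> enc ` Q" "y \<in> enc ` Q" "v \<in> dec x" "v \<in> dec y" for x y v
    proof -
      obtain p q where "x = enc p" "y = enc q" "p \<in> Q" "q \<in> Q" using xy by blast
      then show ?thesis
        using xy fin partition_on_same_block[OF assms(1), of p q v] by simp
    qed
  qed
  show "inflate dec (enc ` Q) = U"
    using fin partition_onD1[OF assms(1)] by (auto simp: inflate_def)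
qed

lemma partition_on_bij_image:
  assumes "bij_betw \<sigma> U V" "partition_on U P"
  shows "partition_on V ((`) \<sigma> ` P)"
proof -
  interpret disjoint_fibres "\<lambda>x. {\<sigma> x}" U
    using assms(1) by (intro disjoint_fibres_singletons) (simp add: bij_betw_def)
  show ?thesis
    using partition_on_inflate[OF assms(2)] assms(1)
    by (simp add: inflate_singletons bij_betw_def)
qed

section \<open>The meet of a family of partitions\<close>

text \<open>
  The block of the meet through \<open>u\<close> is the intersection of the blocks of the \<open>P i\<close> through \<open>u\<close>.
\<close>

lemma block_of_partitions_meet:
  assumes P: "\<And>i. i \<in> {1..k} \<Longrightarrow> partition_on U (P i)" and u: "u \<in> U"
  shows "\<exists>q\<in>partitions_meet k P. u \<in> q \<and> (\<forall>i\<in>{1..k}. \<forall>p\<in>P i. u \<in> p \<longrightarrow> q \<subseteq> p)"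
proof -
  have "\<exists>p. p \<in> P i \<and> u \<in> p" if "i \<in> {1..k}" for i
    using u partition_onD1[OF P[OF that]] by auto
  then obtain B where B: "\<forall>i\<in>{1..k}. B i \<in> P i \<and> u \<in> B i"
    using bchoice[of "{1..k}" "\<lambda>i p. p \<in> P i \<and> u \<in> p"] by auto
  show ?thesis
  proof (intro bexI conjI ballI impI)
    show "(\<Inter>i\<in>{1..k}. B i) \<in> partitions_meet k P" using B unfolding partitions_meet_def by blast
    show "u \<in> (\<Inter>i\<in>{1..k}. B i)" using B by blast
    fix i p assume i: "i \<in> {1..k}" and p: "p \<in> P i" "u \<in> p"
    have "B i = p" using partition_on_same_block[OF P[OF i], of "B i" p u] B i p by simp
    then show "(\<Inter>i\<in>{1..k}. B i) \<subseteq> p" using i by blast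
  qed
qed

lemma partition_on_partitions_meet:
  assumes k: "k \<ge> 1" and P: "\<And>i. i \<in> {1..k} \<Longrightarrow> partition_on U (P i)"
  shows "partition_on U (partitions_meet k P)"
proof (rule partition_onI)
  have 1: "1 \<in> {1..k}" using k by simp
  show "{} \<notin> partitions_meet k P"
    by (simp add: partitions_meet_def)
  show "\<Union> (partitions_meet k P) = U"
  proof
    show "\<Union> (partitions_meet k P) \<subseteq> U"
      using 1 partition_on_block_subset[OF P[OF 1]] unfolding partitions_meet_def by blast
    show "U \<subseteq> \<Union> (partitions_meet k P)"
    proof
      fix u assume "u \<in> U"
      with P show "u \<in> \<Union> (partitions_meet k P)"
        using block_of_partitions_meet[where P = P and k = k] by blast
    qed
  qed
  fix p q assume pq: "p \<in> partitions_meet k P" "q \<in> partitions_meet k P" "p \<noteq> q"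
  obtain B C where B: "\<forall>i\<in>{1..k}. B i \<in> P i" "p = (\<Inter>i\<in>{1..k}. B i)"
    and C: "\<forall>i\<in>{1..k}. C i \<in> P i" "q = (\<Inter>i\<in>{1..k}. C i)"
    using pq unfolding partitions_meet_def by blast
  show "disjnt p q"
  proof (rule ccontr)
    assume "\<not> disjnt p q"
    then obtain u where u: "u \<in> p" "u \<in> q" by (auto simp: disjnt_def)
    have "B i = C i" if i: "i \<in> {1..k}" for i
      using partition_on_same_block[OF P[OF i], of "B i" "C i" u] u B C i by simp
    then show False using B C pq by simp
  qed
qed

lemma block_eq_Union_partitions_meet:
  assumes P: "\<And>i. i \<in> {1..k} \<Longrightarrow> partition_on U (P i)" and i: "i \<in> {1..k}" and p: "p \<in> P i"
  shows "p = \<Union> {q \<in> partitions_meet k P. q \<subseteq> p}"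
proof
  show "p \<subseteq> \<Union> {q \<in> partitions_meet k P. q \<subseteq> p}"
  proof
    fix u assume u: "u \<in> p"
    then have "u \<in> U" using partition_on_block_subset[OF P[OF i] p] by blast
    then have "\<exists>q\<in>partitions_meet k P. u \<in> q \<and> (\<forall>i\<in>{1..k}. \<forall>p\<in>P i. u \<in> p \<longrightarrow> q \<subseteq> p)"
      using P by (intro block_of_partitions_meet)
    then show "u \<in> \<Union> {q \<in> partitions_meet k P. q \<subseteq> p}" using i p u by blast
  qed
qed blast

lemma partitions_meet_cong:
  "(\<And>i. i \<in> {1..k} \<Longrightarrow> P i = P' i) \<Longrightarrow> partitions_meet k P = partitions_meet k P'"
  unfolding partitions_meet_def by simp

section \<open>Maps between sets of encoded blocks\<close>

text \<open>
  The map on encoded blocks given by an arbitrary map \<open>f\<close> on blocks. It covers both \<open>block_map \<sigma>\<close>,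
  for \<open>f\<close> the image under \<open>\<sigma>\<close>, and the map from the blocks of \<open>\<pi>\<^sub>i\<close> to the blocks of the
  coarsened partition of \<open>U\<close>, for \<open>f = inflate dec\<close>.
\<close>

definition block_lift :: "('a hf set \<Rightarrow> 'a hf set) \<Rightarrow> 'a hf \<Rightarrow> 'a hf" where
  "block_lift f x = enc (f (dec x))"

lemma block_map_eq_block_lift: "block_map \<sigma> = block_lift ((`) \<sigma>)"
  by (simp add: fun_eq_iff block_map_def block_lift_def)

lemma finite_dec [simp]: "finite (dec x)"
  by (cases x) simp_all

lemma dec_block_map [simp]: "dec (block_map \<sigma> x) = \<sigma> ` dec x"
  by (simp add: block_map_def)

lemma bij_betw_block_lift:
  assumes "inj_on f P" "\<And>p. p \<in> P \<Longrightarrow> finite p" "\<And>p. p \<in> P \<Longrightarrow> finite (f p)"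
  shows "bij_betw (block_lift f) (enc ` P) (enc ` f ` P)"
proof (rule bij_betw_imageI)
  show "inj_on (block_lift f) (enc ` P)"
  proof (rule inj_onI, clarify)
    fix p q assume pq: "p \<in> P" "q \<in> P" "block_lift f (enc p) = block_lift f (enc q)"
    then have "dec (enc (f p)) = dec (enc (f q))" using assms(2) by (simp add: block_lift_def)
    then have "f p = f q" using pq assms(3) by simp
    then show "enc p = enc q" using pq assms(1) by (auto dest: inj_onD)
  qed
  show "block_lift f ` enc ` P = enc ` f ` P"
    using assms(2) by (auto simp: block_lift_def image_iff)
qed

lemma bij_betw_block_map:
  assumes "bij_betw \<sigma> U V" "partition_on U P" "finite U"
  shows "bij_betw (block_map \<sigma>) (enc ` P) (enc ` (`) \<sigma> ` P)"
  unfolding block_map_eq_block_lift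
proof (rule bij_betw_block_lift)
  have sub: "P \<subseteq> Pow U" using partition_on_block_subset[OF assms(2)] by blast
  then show "inj_on ((`) \<sigma>) P"
    using assms(1) by (meson bij_betw_def inj_on_image_Pow inj_on_subset)
  show "finite p" "finite (\<sigma> ` p)" if "p \<in> P" for p
    using finite_blocks[OF assms(2,3) that] by simp_all
qed

section \<open>Substitution and the modified arithmetic product are species\<close>

lemma species_subst_nonempty_sets:
  assumes M: "species M"
  shows "species (subst_nonempty_sets M)"
proof (rule speciesI, goal_cases)
  case (1 U)
  then show ?case
    by (auto simp: subst_nonempty_sets_def finitely_many_partition_on
        intro!: finite_SigmaI species_finite[OF M] finite_imageI dest: finite_elements)
next
  case (2 U V \<sigma> s)
  then show ?case
    by (auto simp: subst_nonempty_sets_def partition_on_bij_image finite_elements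
        intro!: species_transport_in[OF M _ bij_betw_block_map])
next
  case (3 U s)
  then obtain P m where s: "s = (P, m)" and P: "partition_on U P"
    and m: "m \<in> structures M (enc ` P)"
    by (auto simp: subst_nonempty_sets_def)
  have fin: "finite (enc ` P)" using P 3(1) by (simp add: finite_elements)
  have "transport M (enc ` P) (block_map id) m = transport M (enc ` P) id m"
    using bij_betw_block_map[OF bij_betw_id P 3(1)] finite_blocks[OF P 3(1)]
    by (intro species_transport_cong[OF M fin _ _ m]) (auto simp: block_map_def)
  then show ?case
    using species_transport_id[OF M fin m] by (simp add: subst_nonempty_sets_def s)
next
  case (4 U V W \<sigma> \<tau> s)
  then obtain P m where s: "s = (P, m)" and P: "partition_on U P"
    and m: "m \<in> structures M (enc ` P)"
    by (auto simp: subst_nonempty_sets_def)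
  have fin: "finite (enc ` P)" using P 4(1) by (simp add: finite_elements)
  have V: "finite V" using 4 bij_betw_finite by blast
  have "block_map (\<tau> \<circ> \<sigma>) = block_map \<tau> \<circ> block_map \<sigma>"
    by (simp add: fun_eq_iff block_map_def image_comp)
  then have "transport M (enc ` P) (block_map (\<tau> \<circ> \<sigma>)) m =
      transport M (enc ` (`) \<sigma> ` P) (block_map \<tau>) (transport M (enc ` P) (block_map \<sigma>) m)"
    using species_transport_comp[OF M fin bij_betw_block_map[OF 4(2) P 4(1)]
        bij_betw_block_map[OF 4(3) partition_on_bij_image[OF 4(2) P] V] m] by simp
  then show ?case by (simp add: subst_nonempty_sets_def s image_comp comp_def)
next
  case (5 U V \<sigma> \<tau> s)
  then obtain P m where s: "s = (P, m)" and P: "partition_on U P"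
    and m: "m \<in> structures M (enc ` P)"
    by (auto simp: subst_nonempty_sets_def)
  have fin: "finite (enc ` P)" using P 5(1) by (simp add: finite_elements)
  have eq: "\<sigma> ` p = \<tau> ` p" if "p \<in> P" for p
    using 5(3) partition_on_block_subset[OF P that] by (intro image_cong) auto
  have "transport M (enc ` P) (block_map \<sigma>) m = transport M (enc ` P) (block_map \<tau>) m"
    using eq finite_blocks[OF P 5(1)]
    by (intro species_transport_cong[OF M fin bij_betw_block_map[OF 5(2) P 5(1)] _ m])
      (auto simp: block_map_def)
  then show ?case using eq by (simp add: subst_nonempty_sets_def s cong: image_cong)
qed

lemma partial_rectanglesD:
  "\<pi> \<in> partial_rectangles k U \<Longrightarrow> i \<in> {1..k} \<Longrightarrow> partition_on U (\<pi> i)"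
  by (auto simp: partial_rectangles_def)

lemma partial_rectangles_bij_image:
  assumes k: "k \<ge> 1" and \<sigma>: "bij_betw \<sigma> U V" and \<pi>: "\<pi> \<in> partial_rectangles k U"
  shows "(\<lambda>i\<in>{1..k}. (`) \<sigma> ` \<pi> i) \<in> partial_rectangles k V"
proof -
  interpret disjoint_fibres "\<lambda>x. {\<sigma> x}" U
    using \<sigma> by (intro disjoint_fibres_singletons) (simp add: bij_betw_def)
  have part: "partition_on U (\<pi> i)" if "i \<in> {1..k}" for i
    using \<pi> that by (auto simp: partial_rectangles_def)
  have sub: "\<pi> i \<subseteq> Pow U" if "i \<in> {1..k}" for i
    using partition_on_block_subset[OF part[OF that]] by blast
  have "partitions_meet k (\<lambda>i\<in>{1..k}. (`) \<sigma> ` \<pi> i) = partitions_meet k (\<lambda>i. (`) \<sigma> ` \<pi> i)"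
    by (rule partitions_meet_cong) simp
  also have "\<dots> = (`) \<sigma> ` partitions_meet k \<pi>"
    using partitions_meet_inflate[OF k sub] by (simp add: inflate_singletons)
  also have "\<dots> = (\<lambda>v. {v}) ` V"
    using \<pi> \<sigma> by (auto simp: partial_rectangles_def bij_betw_def)
  finally show ?thesis
    using partition_on_bij_image[OF \<sigma> part] by (simp add: partial_rectangles_def)
qed

lemma PiE_eqI:
  assumes "f \<in> Pi\<^sub>E I A" "g \<in> Pi\<^sub>E I B" "\<And>i. i \<in> I \<Longrightarrow> f i = g i"
  shows "f = g"
  using assms by (auto intro: extensionalityI simp: PiE_iff)

text \<open>
  Pairing \<open>\<pi> i\<close> with \<open>m i\<close> embeds the modified arithmetic product into the cartesian product of the
  \<open>M\<^sub>i(E\<^sub>+)\<close>. The image is closed under transport because relabelled partial rectangles are partial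
  rectangles.
\<close>

lemma species_modified_arithmetic_product:
  assumes k: "k \<ge> 1" and M: "\<And>i. i \<in> {1..k} \<Longrightarrow> species (M i)"
  shows "species (modified_arithmetic_product k M)"
proof (rule species_of_embedding
    [where \<eta> = "\<lambda>U (\<pi>, m). \<lambda>i\<in>{1..k}. (\<pi> i, m i)"
      and G = "cartesian_product k (\<lambda>i. subst_nonempty_sets (M i))"], goal_cases)
  case 1
  show ?case by (intro species_cartesian_product species_subst_nonempty_sets M)
next
  case (2 U)
  show ?case
  proof (rule inj_onI, clarify)
    fix \<pi> m \<pi>' m'
    assume s: "(\<pi>, m) \<in> structures (modified_arithmetic_product k M) U"
      "(\<pi>', m') \<in> structures (modified_arithmetic_product k M) U"
      and eq: "(\<lambda>i\<in>{1..k}. (\<pi> i, m i)) = (\<lambda>i\<in>{1..k}. (\<pi>' i, m' i))"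
    have "\<pi> i = \<pi>' i \<and> m i = m' i" if "i \<in> {1..k}" for i
      using fun_cong[OF eq, of i] that by simp
    moreover have "\<pi> \<in> {1..k} \<rightarrow>\<^sub>E {P. partition_on U P}" "\<pi>' \<in> {1..k} \<rightarrow>\<^sub>E {P. partition_on U P}"
      "m \<in> (\<Pi>\<^sub>E i\<in>{1..k}. structures (M i) (enc ` \<pi> i))"
      "m' \<in> (\<Pi>\<^sub>E i\<in>{1..k}. structures (M i) (enc ` \<pi>' i))"
      using s by (simp_all add: modified_arithmetic_product_def partial_rectangles_def)
    ultimately show "\<pi> = \<pi>' \<and> m = m'"
      using PiE_eqI[of \<pi> _ _ \<pi>'] PiE_eqI[of m _ _ m'] by meson
  qed
next
  case (3 U s)
  then show ?case
    by (auto simp: modified_arithmetic_product_def partial_rectangles_def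
        cartesian_product_def subst_nonempty_sets_def PiE_iff)
next
  case (4 U V \<sigma> s)
  then obtain \<pi> m where s: "s = (\<pi>, m)" and \<pi>: "\<pi> \<in> partial_rectangles k U"
    and m: "m \<in> (\<Pi>\<^sub>E i\<in>{1..k}. structures (M i) (enc ` \<pi> i))"
    by (auto simp: modified_arithmetic_product_def)
  have part: "partition_on U (\<pi> i)" if "i \<in> {1..k}" for i
    using \<pi> that by (auto simp: partial_rectangles_def)
  have "transport (M i) (enc ` \<pi> i) (block_map \<sigma>) (m i) \<in> structures (M i) (enc ` (`) \<sigma> ` \<pi> i)"
    if "i \<in> {1..k}" for i
    using finite_elements[OF 4(1) part[OF that]]
    by (intro species_transport_in[OF M[OF that] _ bij_betw_block_map[OF 4(2) part[OF that] 4(1)]]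
        PiE_mem[OF m that]) simp
  then show ?case
    using partial_rectangles_bij_image[OF k 4(2) \<pi>]
    by (simp add: modified_arithmetic_product_def s PiE_iff)
next
  case (5 U V \<sigma> s)
  then show ?case
    by (auto simp: modified_arithmetic_product_def cartesian_product_def subst_nonempty_sets_def
        restrict_def fun_eq_iff)
qed

section \<open>The isomorphism\<close>

text \<open>
  The natural isomorphism. The partition \<open>Q\<close> is dropped: it can be recovered as the meet of the resulting partitions (\<open>meet_of_coarsened_rectangle\<close>).
\<close>

definition coarsen ::
  "nat \<Rightarrow> (nat \<Rightarrow> ('a hf, 's) species_data) \<Rightarrow>
   'a hf set set \<times> (nat \<Rightarrow> 'a hf set set) \<times> (nat \<Rightarrow> 's) \<Rightarrow> nat \<Rightarrow> 'a hf set set \<times> 's" where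
  "coarsen k M = (\<lambda>(Q, \<pi>, m). \<lambda>i\<in>{1..k}.
     (inflate dec ` \<pi> i, transport (M i) (enc ` \<pi> i) (block_lift (inflate dec)) (m i)))"

lemma finite_inflate_dec: "finite X \<Longrightarrow> finite (inflate dec X)"
  by (simp add: inflate_def)

lemma mem_subst_modified_arithmetic_product:
  "(Q, \<pi>, m) \<in> structures (subst_nonempty_sets (modified_arithmetic_product k M)) U \<longleftrightarrow>
     partition_on U Q \<and> \<pi> \<in> partial_rectangles k (enc ` Q) \<and>
     m \<in> (\<Pi>\<^sub>E i\<in>{1..k}. structures (M i) (enc ` \<pi> i))"
  by (simp add: subst_nonempty_sets_def modified_arithmetic_product_def)

lemma bij_betw_union_of_blocks:
  assumes "partition_on U Q" "finite U" "partition_on (enc ` Q) \<pi>"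
  shows "bij_betw (block_lift (inflate dec)) (enc ` \<pi>) (enc ` inflate dec ` \<pi>)"
proof (rule bij_betw_block_lift)
  interpret disjoint_fibres dec "enc ` Q" by (rule disjoint_fibres_dec[OF assms(1,2)])
  have sub: "\<pi> \<subseteq> Pow (enc ` Q)" using partition_on_block_subset[OF assms(3)] by blast
  show "inj_on (inflate dec) \<pi>" using inj_on_inflate sub by (rule inj_on_subset)
  have "finite (enc ` Q)" using finite_elements[OF assms(2,1)] by simp
  then show "finite p" if "p \<in> \<pi>" for p using finite_blocks[OF assms(3)] that by blast
  then show "finite (inflate dec p)" if "p \<in> \<pi>" for p
    using that by (simp add: finite_inflate_dec)
qed

text \<open>
  The union of a one-element set of encoded blocks is that block, so the trivial partition of
  \<open>enc ` Q\<close> inflates to \<open>Q\<close>. As inflation commutes with meets and is injective, nothing else does.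
\<close>

lemma partitions_meet_inflate_dec:
  assumes k: "k \<ge> 1" and Q: "partition_on U Q" and U: "finite U"
    and \<pi>: "\<And>i. i \<in> {1..k} \<Longrightarrow> partition_on (enc ` Q) (\<pi> i)"
  shows "partitions_meet k (\<lambda>i. inflate dec ` \<pi> i) = Q \<longleftrightarrow>
    partitions_meet k \<pi> = (\<lambda>u. {u}) ` enc ` Q"
proof -
  interpret disjoint_fibres dec "enc ` Q" by (rule disjoint_fibres_dec[OF Q U])
  have sub: "\<pi> i \<subseteq> Pow (enc ` Q)" if "i \<in> {1..k}" for i
    using partition_on_block_subset[OF \<pi>[OF that]] by blast
  have Q': "inflate dec ` (\<lambda>u. {u}) ` enc ` Q = Q"
    using finite_blocks[OF Q U] by (simp add: image_image inflate_def)
  have "partitions_meet k \<pi> \<subseteq> Pow (enc ` Q)"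
    using partition_on_block_subset[OF partition_on_partitions_meet[where P = \<pi>, OF k \<pi>]] by blast
  then have "inflate dec ` partitions_meet k \<pi> = inflate dec ` (\<lambda>u. {u}) ` enc ` Q \<longleftrightarrow>
      partitions_meet k \<pi> = (\<lambda>u. {u}) ` enc ` Q"
    by (intro inj_on_image_eq_iff[OF inj_on_inflate]) auto
  then show ?thesis using partitions_meet_inflate[OF k sub] Q' by simp
qed

lemma structures_cartesian_subst:
  "structures (cartesian_product k (\<lambda>i. subst_nonempty_sets (M i))) U =
    (\<Pi>\<^sub>E i\<in>{1..k}. SIGMA P:{P. partition_on U P}. structures (M i) (enc ` P))"
  by (simp add: cartesian_product_def subst_nonempty_sets_def)

lemma coarsen_transport_bij:
  assumes "species N" "finite U" "partition_on U Q" "partition_on (enc ` Q) \<rho>"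
  shows "bij_betw (transport N (enc ` \<rho>) (block_lift (inflate dec)))
    (structures N (enc ` \<rho>)) (structures N (enc ` inflate dec ` \<rho>))"
  using finite_elements[OF assms(2,3)] finite_elements[OF _ assms(4)]
  by (intro species_transport_bij[OF assms(1) _ bij_betw_union_of_blocks[OF assms(3,2,4)]]) simp

lemma meet_of_coarsened_rectangle:
  assumes "k \<ge> 1" "finite U" "partition_on U Q" "\<pi> \<in> partial_rectangles k (enc ` Q)"
  shows "Q = partitions_meet k (\<lambda>i. inflate dec ` \<pi> i)"
  using partitions_meet_inflate_dec[where \<pi> = \<pi>,
      OF assms(1,3,2) partial_rectanglesD[OF assms(4)]] assms(4)
  by (simp add: partial_rectangles_def)

text \<open>
  The images determine \<open>Q\<close> as their meet; on sets of encoded blocks of this \<open>Q\<close> the union is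
  injective, which determines \<open>\<pi>\<close>; and transport along a bijection determines \<open>m\<close>.
\<close>

lemma inj_on_coarsen:
  assumes k: "k \<ge> 1" and M: "\<And>i. i \<in> {1..k} \<Longrightarrow> species (M i)" and U: "finite U"
  shows "inj_on (coarsen k M)
    (structures (subst_nonempty_sets (modified_arithmetic_product k M)) U)"
    (is "inj_on _ ?L")
proof (rule inj_onI)
  fix x x' assume x: "x \<in> ?L" "x' \<in> ?L" "coarsen k M x = coarsen k M x'"
  obtain Q \<pi> m Q' \<pi>' m' where xx': "x = (Q, \<pi>, m)" "x' = (Q', \<pi>', m')"
    by (metis prod_cases3)
  with x have s: "(Q, \<pi>, m) \<in> ?L" and s': "(Q', \<pi>', m') \<in> ?L"
    and eq: "coarsen k M (Q, \<pi>, m) = coarsen k M (Q', \<pi>', m')"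
    by simp_all
  have Q: "partition_on U Q" and \<pi>: "\<pi> \<in> partial_rectangles k (enc ` Q)"
    and m: "m \<in> (\<Pi>\<^sub>E i\<in>{1..k}. structures (M i) (enc ` \<pi> i))"
    using s by (simp_all add: mem_subst_modified_arithmetic_product)
  have Q': "partition_on U Q'" and \<pi>': "\<pi>' \<in> partial_rectangles k (enc ` Q')"
    and m': "m' \<in> (\<Pi>\<^sub>E i\<in>{1..k}. structures (M i) (enc ` \<pi>' i))"
    using s' by (simp_all add: mem_subst_modified_arithmetic_product)
  interpret disjoint_fibres dec "enc ` Q" by (rule disjoint_fibres_dec[OF Q U])
  have eqi: "inflate dec ` \<pi> i = inflate dec ` \<pi>' i"
    "transport (M i) (enc ` \<pi> i) (block_lift (inflate dec)) (m i) =
     transport (M i) (enc ` \<pi>' i) (block_lift (inflate dec)) (m' i)"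
    if "i \<in> {1..k}" for i
    using fun_cong[OF eq, of i] that by (simp_all add: coarsen_def)
  have "Q = partitions_meet k (\<lambda>i. inflate dec ` \<pi> i)"
    by (rule meet_of_coarsened_rectangle[OF k U Q \<pi>])
  also have "\<dots> = partitions_meet k (\<lambda>i. inflate dec ` \<pi>' i)"
    by (rule partitions_meet_cong) (rule eqi(1))
  also have "\<dots> = Q'" by (rule meet_of_coarsened_rectangle[OF k U Q' \<pi>', symmetric])
  finally have QQ: "Q = Q'" .
  have \<pi>i: "\<pi> i = \<pi>' i" if i: "i \<in> {1..k}" for i
  proof (rule inj_on_image_eq_iff[OF inj_on_inflate, THEN iffD1, OF _ _ eqi(1)[OF i]])
    show "\<pi> i \<subseteq> Pow (enc ` Q)"
      using partition_on_block_subset[OF partial_rectanglesD[OF \<pi> i]] by blast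
    show "\<pi>' i \<subseteq> Pow (enc ` Q)"
      using partition_on_block_subset[OF partial_rectanglesD[OF \<pi>' i]] QQ by blast
  qed
  have "m i = m' i" if i: "i \<in> {1..k}" for i
  proof -
    note tr = coarsen_transport_bij[OF M[OF i] U Q partial_rectanglesD[OF \<pi> i]]
    show ?thesis
      by (rule inj_onD[OF bij_betw_imp_inj_on[OF tr] _ PiE_mem[OF m i]])
        (use eqi(2)[OF i] PiE_mem[OF m' i] in \<open>simp_all only: \<pi>i[OF i]\<close>)
  qed
  then have "m = m'" by (rule PiE_eqI[OF m m'])
  moreover have "\<pi> = \<pi>'"
  proof (rule PiE_eqI)
    show "\<pi> \<in> {1..k} \<rightarrow>\<^sub>E {P. partition_on (enc ` Q) P}"
      using \<pi> by (simp add: partial_rectangles_def)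
    show "\<pi>' \<in> {1..k} \<rightarrow>\<^sub>E {P. partition_on (enc ` Q') P}"
      using \<pi>' by (simp add: partial_rectangles_def)
  qed (rule \<pi>i)
  ultimately show "x = x'" using QQ xx' by simp
qed

lemma coarsen_into:
  assumes M: "\<And>i. i \<in> {1..k} \<Longrightarrow> species (M i)" and U: "finite U"
  shows "coarsen k M ` structures (subst_nonempty_sets (modified_arithmetic_product k M)) U
    \<subseteq> structures (cartesian_product k (\<lambda>i. subst_nonempty_sets (M i))) U"
    (is "_ ` ?L \<subseteq> ?R")
proof clarify
  fix Q \<pi> m
  assume "(Q, \<pi>, m) \<in> ?L"
  then have Q: "partition_on U Q" and \<pi>: "\<pi> \<in> partial_rectangles k (enc ` Q)"
    and m: "m \<in> (\<Pi>\<^sub>E i\<in>{1..k}. structures (M i) (enc ` \<pi> i))"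
    by (simp_all add: mem_subst_modified_arithmetic_product)
  interpret disjoint_fibres dec "enc ` Q" by (rule disjoint_fibres_dec[OF Q U])
  have "partition_on U (inflate dec ` \<pi> i)" if "i \<in> {1..k}" for i
    using partition_on_inflate[OF partial_rectanglesD[OF \<pi> that]] disjoint_fibres_dec(2)[OF Q U]
    by simp
  moreover have "transport (M i) (enc ` \<pi> i) (block_lift (inflate dec)) (m i)
      \<in> structures (M i) (enc ` inflate dec ` \<pi> i)" if "i \<in> {1..k}" for i
    using bij_betwE[OF coarsen_transport_bij[OF M[OF that] U Q partial_rectanglesD[OF \<pi> that]]]
      PiE_mem[OF m that] by blast
  ultimately show "coarsen k M (Q, \<pi>, m) \<in> ?R"
    unfolding structures_cartesian_subst by (simp add: coarsen_def PiE_iff)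
qed

text \<open>
  Given partitions \<open>P i\<close> of \<open>U\<close>, let \<open>Q\<close> be their meet. Each block of \<open>P i\<close> is a union of blocks of
  \<open>Q\<close>, so \<open>P i\<close> comes from a partition of \<open>enc ` Q\<close>, and these partitions form a partial rectangle
  because the meet of the \<open>P i\<close> is \<open>Q\<close>.
\<close>

lemma coarsen_onto:
  assumes k: "k \<ge> 1" and M: "\<And>i. i \<in> {1..k} \<Longrightarrow> species (M i)" and U: "finite U"
  shows "structures (cartesian_product k (\<lambda>i. subst_nonempty_sets (M i))) U
    \<subseteq> coarsen k M ` structures (subst_nonempty_sets (modified_arithmetic_product k M)) U"
    (is "?R \<subseteq> _ ` ?L")
proof
  fix s assume s: "s \<in> ?R"
  define P where "P i = fst (s i)" for i
  have P: "partition_on U (P i)" and sm: "snd (s i) \<in> structures (M i) (enc ` P i)"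
    if "i \<in> {1..k}" for i
    using s that unfolding structures_cartesian_subst P_def by (force simp: PiE_iff)+
  define Q where "Q = partitions_meet k P"
  have Q: "partition_on U Q"
    unfolding Q_def by (rule partition_on_partitions_meet[OF k P])
  interpret disjoint_fibres dec "enc ` Q" by (rule disjoint_fibres_dec[OF Q U])
  have "\<exists>x. partition_on (enc ` Q) (fst x) \<and> inflate dec ` fst x = P i \<and>
      snd x \<in> structures (M i) (enc ` fst x) \<and>
      transport (M i) (enc ` fst x) (block_lift (inflate dec)) (snd x) = snd (s i)"
    if i: "i \<in> {1..k}" for i
  proof -
    have "p = inflate dec (enc ` {q \<in> Q. q \<subseteq> p})" if p: "p \<in> P i" for p
      using block_eq_Union_partitions_meet[where P = P and k = k, OF P i p] finite_blocks[OF Q U]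
      by (simp add: inflate_def Q_def)
    then have "P i \<subseteq> inflate dec ` Pow (enc ` Q)" by blast
    then obtain \<rho> where \<rho>: "partition_on (enc ` Q) \<rho>" "inflate dec ` \<rho> = P i"
      using partition_on_deflate P[OF i] disjoint_fibres_dec(2)[OF Q U] by metis
    moreover obtain n where "n \<in> structures (M i) (enc ` \<rho>)"
      "transport (M i) (enc ` \<rho>) (block_lift (inflate dec)) n = snd (s i)"
      using coarsen_transport_bij[OF M[OF i] U Q \<rho>(1)] sm[OF i] \<rho>(2)
      unfolding bij_betw_def by (metis imageE)
    ultimately show ?thesis by (intro exI[of _ "(\<rho>, n)"]) simp
  qed
  then obtain x where x: "\<And>i. i \<in> {1..k} \<Longrightarrow> partition_on (enc ` Q) (fst (x i)) \<and>
      inflate dec ` fst (x i) = P i \<and> snd (x i) \<in> structures (M i) (enc ` fst (x i)) \<and>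
      transport (M i) (enc ` fst (x i)) (block_lift (inflate dec)) (snd (x i)) = snd (s i)"
    by metis
  define \<pi> where "\<pi> = (\<lambda>i\<in>{1..k}. fst (x i))"
  define m where "m = (\<lambda>i\<in>{1..k}. snd (x i))"
  have part: "partition_on (enc ` Q) (\<pi> i)" if "i \<in> {1..k}" for i
    using x that by (simp add: \<pi>_def)
  have "partitions_meet k (\<lambda>i. inflate dec ` \<pi> i) = Q"
    unfolding Q_def by (rule partitions_meet_cong) (use x in \<open>simp add: \<pi>_def\<close>)
  then have "partitions_meet k \<pi> = (\<lambda>u. {u}) ` enc ` Q"
    using partitions_meet_inflate_dec[where \<pi> = \<pi>, OF k Q U part] by blast
  then have "\<pi> \<in> partial_rectangles k (enc ` Q)"
    using x by (simp add: partial_rectangles_def \<pi>_def)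
  moreover have "m \<in> (\<Pi>\<^sub>E i\<in>{1..k}. structures (M i) (enc ` \<pi> i))"
    using x by (simp add: m_def \<pi>_def)
  ultimately have "(Q, \<pi>, m) \<in> ?L"
    using Q by (simp add: mem_subst_modified_arithmetic_product)
  moreover have "s = coarsen k M (Q, \<pi>, m)"
  proof
    fix i
    show "s i = coarsen k M (Q, \<pi>, m) i"
    proof (cases "i \<in> {1..k}")
      case True
      then show ?thesis using x[OF True]
        by (simp add: coarsen_def \<pi>_def m_def P_def)
    next
      case False
      then have "s i = undefined" using s[unfolded structures_cartesian_subst] by (intro PiE_arb)
      with False show ?thesis by (auto simp: coarsen_def)
    qed
  qed
  ultimately show "s \<in> coarsen k M ` ?L" by blast
qed

lemma coarsen_bij:
  assumes k: "k \<ge> 1" and M: "\<And>i. i \<in> {1..k} \<Longrightarrow> species (M i)" and U: "finite U"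
  shows "bij_betw (coarsen k M)
    (structures (subst_nonempty_sets (modified_arithmetic_product k M)) U)
    (structures (cartesian_product k (\<lambda>i. subst_nonempty_sets (M i))) U)"
  by (intro bij_betw_imageI equalityI inj_on_coarsen coarsen_into coarsen_onto k M U)

lemma inflate_dec_block_map: "inflate dec (block_map \<sigma> ` X) = \<sigma> ` inflate dec X"
  by (auto simp: inflate_def)

text \<open>
  On partitions this is the previous lemma. On structures both sides are transports along composite
  bijections, and the two composites agree since unions of blocks commute with relabelling.
\<close>

lemma coarsen_natural:
  assumes M: "\<And>i. i \<in> {1..k} \<Longrightarrow> species (M i)" and U: "finite U" and \<sigma>: "bij_betw \<sigma> U V"
    and s: "s \<in> structures (subst_nonempty_sets (modified_arithmetic_product k M)) U"
  shows "coarsen k M (transport (subst_nonempty_sets (modified_arithmetic_product k M)) U \<sigma> s) =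
    transport (cartesian_product k (\<lambda>i. subst_nonempty_sets (M i))) U \<sigma> (coarsen k M s)"
proof -
  obtain Q \<pi> m where s_eq: "s = (Q, \<pi>, m)" by (cases s)
  have Q: "partition_on U Q" and \<pi>: "\<pi> \<in> partial_rectangles k (enc ` Q)"
    and m: "m \<in> (\<Pi>\<^sub>E i\<in>{1..k}. structures (M i) (enc ` \<pi> i))"
    using s by (simp_all add: s_eq mem_subst_modified_arithmetic_product)
  let ?\<beta> = "block_map \<sigma>"
  let ?f = "block_lift (inflate dec)"
  have V: "finite V" using U \<sigma> bij_betw_finite by blast
  have \<beta>: "bij_betw ?\<beta> (enc ` Q) (enc ` (`) \<sigma> ` Q)" by (rule bij_betw_block_map[OF \<sigma> Q U])
  have finQ: "finite (enc ` Q)" using finite_elements[OF U Q] by simp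
  have partition_eq: "inflate dec ` (`) ?\<beta> ` \<rho> = (`) \<sigma> ` inflate dec ` \<rho>" for \<rho>
    by (simp add: image_image inflate_dec_block_map)
  have "transport (M i) (enc ` (`) ?\<beta> ` \<pi> i) ?f
      (transport (M i) (enc ` \<pi> i) (block_map ?\<beta>) (m i)) =
    transport (M i) (enc ` inflate dec ` \<pi> i) ?\<beta> (transport (M i) (enc ` \<pi> i) ?f (m i))"
    (is "?lhs = ?rhs") if i: "i \<in> {1..k}" for i
  proof -
    have part: "partition_on (enc ` Q) (\<pi> i)"
      using \<pi> i by (auto simp: partial_rectangles_def)
    have fin: "finite (enc ` \<pi> i)" using finite_elements[OF finQ part] by simp
    have mi: "m i \<in> structures (M i) (enc ` \<pi> i)" using m i by blast
    interpret disjoint_fibres dec "enc ` Q" by (rule disjoint_fibres_dec[OF Q U])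
    have flat: "partition_on U (inflate dec ` \<pi> i)"
      using partition_on_inflate[OF part] disjoint_fibres_dec(2)[OF Q U] by simp
    have b1: "bij_betw (block_map ?\<beta>) (enc ` \<pi> i) (enc ` (`) ?\<beta> ` \<pi> i)"
      by (rule bij_betw_block_map[OF \<beta> part finQ])
    have b2: "bij_betw ?f (enc ` (`) ?\<beta> ` \<pi> i) (enc ` inflate dec ` (`) ?\<beta> ` \<pi> i)"
      by (rule bij_betw_union_of_blocks[OF partition_on_bij_image[OF \<sigma> Q] V
            partition_on_bij_image[OF \<beta> part]])
    have b3: "bij_betw ?f (enc ` \<pi> i) (enc ` inflate dec ` \<pi> i)"
      by (rule bij_betw_union_of_blocks[OF Q U part])
    have b4: "bij_betw ?\<beta> (enc ` inflate dec ` \<pi> i) (enc ` (`) \<sigma> ` inflate dec ` \<pi> i)"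
      by (rule bij_betw_block_map[OF \<sigma> flat U])
    \<comment> \<open>On the left, \<open>block_map\<close> is applied twice: \<open>?\<beta>\<close> relabels the blocks of \<open>Q\<close>, and
      \<open>block_map ?\<beta>\<close> relabels sets of them.\<close>
    have "?f \<circ> block_map ?\<beta> = ?\<beta> \<circ> ?f"
      by (simp add: fun_eq_iff block_lift_def inflate_dec_block_map)
        (simp add: block_map_def finite_inflate_dec)
    then show ?thesis
      using species_transport_comp[OF M[OF i] fin b1 b2 mi]
        species_transport_comp[OF M[OF i] fin b3 b4 mi] by simp
  qed
  then show ?thesis
    by (simp add: s_eq coarsen_def subst_nonempty_sets_def modified_arithmetic_product_def
        cartesian_product_def partition_eq restrict_def fun_eq_iff)
qed

theorem theorem5p2:
  fixes k :: nat and M :: "nat \<Rightarrow> ('a hf, 's) species_data"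
  assumes "k \<ge> 1"
    and "\<And>i. i \<in> {1..k} \<Longrightarrow> species (M i)"
  shows "isomorphic_species
           (subst_nonempty_sets (modified_arithmetic_product k M))
           (cartesian_product k (\<lambda>i. subst_nonempty_sets (M i)))"
  unfolding isomorphic_species_def
proof (intro conjI exI)
  show "species (subst_nonempty_sets (modified_arithmetic_product k M))"
    by (intro species_subst_nonempty_sets species_modified_arithmetic_product assms)
  show "species (cartesian_product k (\<lambda>i. subst_nonempty_sets (M i)))"
    by (intro species_cartesian_product species_subst_nonempty_sets assms)
  show "natural_iso (subst_nonempty_sets (modified_arithmetic_product k M))
      (cartesian_product k (\<lambda>i. subst_nonempty_sets (M i))) (\<lambda>U. coarsen k M)"
    unfolding natural_iso_def
    using coarsen_bij[where M = M, OF assms] coarsen_natural[where M = M, OF assms(2)] by blast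
qed

end
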